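(* Let $D\subset\mathbb{C}^n$, $n>1$, be a domain with $C^2$-smooth boundary, let $\xi\in\partial D$, and let $f$ be a function holomorphic in $D$ which has a limit (in $\overline{\mathbb{C}}=\mathbb{C}\cup\{\infty\}$) along the normal $\nu_\xi$ at $\xi$. Then $f$ has an admissible limit at $\xi$ if and only if for every $\alpha>0$ $$(1+|f(z)|^2)^{-1}\,\nabla f(z)\to 0\quad\text{as } z\to\xi,\ z\in A_\alpha(\xi).$$
   Context: Let $\nu_\xi$ be the unit outward normal vector to $\partial D$ at $\xi$. A function $f$ on $D$ has limit $L\in\overline{\mathbb{C}}=\mathbb{C}\cup\{\infty\}$ along the normal $\nu_\xi$ at $\xi$ if $\lim_{t\to0^+}f(\xi-t\nu_\xi)=L$. Coordinates. After a translation and a unitary transformation of $\mathbb{C}^n$ assume $\xi=0$, the inner normal to $\partial D$ at $0$ points in the positive $x_1$ direction, and the complex tangent space to $\partial D$ at $0$ is $\{z: z_1=0\}$. Write $z_j=x_j+iy_j$ and identify $z$ with $(x_1,\zeta)$, $\zeta=(y_1,x_2,y_2,\ldots,x_n,y_n)\in\mathbb{R}^{2n-1}$. There is a real-valued $C^2$ function $\psi$ with $\psi(0)=0$, $\nabla\psi(0)=0$ (real gradient) such that, in a neighbourhood of $\overline V$, where $V$ is a fixed sufficiently small bounded open neighbourhood of $0$, $D$ is given by $x_1>\psi(\zeta)$ and $\partial D$ by $x_1=\psi(\zeta)$. All considerations are local, i.e. for $z\in D\cap V$. Set $d(z)=\min\{x_1,\,x_1-\psi(\zeta)\}$ and, for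 $\alpha>0$, define the admissible approach region with vertex $\xi=0$ by $$A_\alpha(\xi)=\{z\in D\cap V:\ |z|^2<\alpha\, d(z),\ |y_1|<\alpha x_1\}.$$ A function $f$ has an admissible limit $L\in\overline{\mathbb{C}}$ at $\xi$ if, for every $\alpha>0$, $f(z)\to L$ as $z\to\xi$, $z\in A_\alpha(\xi)$ (the value $L=\infty$ is allowed). In these coordinates (fixed, adapted to the point $\xi$), at points where $d(z)>0$, $\nabla f(z)\ge 0$ denotes the non-negative number (not a vector) given by $$(\nabla f(z))^2=d^2(z)\Big|\frac{\partial f}{\partial z_1}(z)\Big|^2+d(z)\sum_{j=2}^n\Big|\frac{\partial f}{\partial z_j}(z)\Big|^2 .$$ *)

theory Defs
  imports "HOL-Analysis.Analysis"
begin

text \<open>The space \<open>\<complex>\<^sup>n\<close> is \<open>complex ^ 'n\<close> with \<open>n = CARD('n)\<close>. Its norm and (real) inner product are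
  those of \<open>\<real>\<^sup>2\<^sup>n\<close>.\<close>

datatype extended_complex = Finite complex | Infinity

fun tends_to_extended :: "('a \<Rightarrow> complex) \<Rightarrow> extended_complex \<Rightarrow> 'a filter \<Rightarrow> bool" where
  "tends_to_extended f (Finite l) F \<longleftrightarrow> (f \<longlongrightarrow> l) F"
| "tends_to_extended f Infinity F \<longleftrightarrow> filterlim f at_infinity F"

definition holomorphic_Cn_on :: "(complex ^ 'n \<Rightarrow> complex) \<Rightarrow> (complex ^ 'n) set \<Rightarrow> bool" where
  "holomorphic_Cn_on f D \<longleftrightarrow>
     open D \<and> (\<forall>z\<in>D. \<exists>f'. (f has_derivative f') (at z) \<and> (\<forall>c v. f' (c *s v) = c * f' v))"

definition complex_partial :: "'n \<Rightarrow> (complex ^ 'n \<Rightarrow> complex) \<Rightarrow> complex ^ 'n \<Rightarrow> complex" where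
  "complex_partial j f z = deriv (\<lambda>h. f (z + axis j h)) 0"

definition C2_on :: "('a::euclidean_space \<Rightarrow> real) \<Rightarrow> 'a set \<Rightarrow> bool" where
  "C2_on g S \<longleftrightarrow> open S \<and>
     (\<exists>(G :: 'a \<Rightarrow> 'a) (H :: 'a \<Rightarrow> 'a \<Rightarrow>\<^sub>L 'a).
        (\<forall>x\<in>S. (g has_derivative (\<lambda>h. G x \<bullet> h)) (at x)) \<and>
        (\<forall>x\<in>S. (G has_derivative blinfun_apply (H x)) (at x)) \<and>
        continuous_on S H)"

definition local_defining_function ::
    "('a::euclidean_space) set \<Rightarrow> 'a \<Rightarrow> 'a set \<Rightarrow> ('a \<Rightarrow> real) \<Rightarrow> bool" where
  "local_defining_function D p N \<rho> \<longleftrightarrow>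
     p \<in> N \<and> C2_on \<rho> N \<and>
     D \<inter> N = {z \<in> N. \<rho> z < 0} \<and>
     frontier D \<inter> N = {z \<in> N. \<rho> z = 0} \<and>
     (\<forall>z \<in> frontier D \<inter> N. \<not> (\<rho> has_derivative (\<lambda>_. 0)) (at z))"

definition C2_boundary :: "('a::euclidean_space) set \<Rightarrow> bool" where
  "C2_boundary D \<longleftrightarrow> (\<forall>p \<in> frontier D. \<exists>N \<rho>. local_defining_function D p N \<rho>)"

definition unit_outward_normal :: "('a::euclidean_space) set \<Rightarrow> 'a \<Rightarrow> 'a \<Rightarrow> bool" where
  "unit_outward_normal D p \<nu> \<longleftrightarrow>
     (\<exists>N \<rho> g. local_defining_function D p N \<rho> \<and>
        (\<rho> has_derivative (\<lambda>h. g \<bullet> h)) (at p) \<and> \<nu> = g /\<^sub>R norm g)"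

definition conj_transpose :: "complex ^ 'n ^ 'm \<Rightarrow> complex ^ 'm ^ 'n" where
  "conj_transpose A = map_matrix cnj (transpose A)"

definition unitary_matrix :: "complex ^ 'n ^ 'n \<Rightarrow> bool" where
  "unitary_matrix U \<longleftrightarrow> conj_transpose U ** U = mat 1 \<and> U ** conj_transpose U = mat 1"

text \<open>From here on \<open>k\<close> is the index of the distinguished coordinate, written \<open>z\<^sub>1\<close> in the usual
  notation. The space \<open>\<real>\<close> to the power \<open>2n - 1\<close> of the variable \<open>\<zeta> = (y\<^sub>1, x\<^sub>2, y\<^sub>2, \<dots>)\<close> is represented
  by the real hyperplane \<open>x\<^sub>1 = 0\<close> in \<open>\<complex>\<^sup>n\<close>, onto which \<open>drop_x1 k\<close> projects. A function \<open>\<psi>\<close> of \<open>\<zeta>\<close> is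
  only evaluated on this hyperplane; it is \<open>C\<^sup>2\<close>, or has zero gradient, as a function of \<open>\<zeta>\<close> exactly
  when \<open>\<lambda>z. \<psi> (drop_x1 k z)\<close> has this property as a function of \<open>z\<close>.\<close>

definition drop_x1 :: "'n \<Rightarrow> complex ^ 'n \<Rightarrow> complex ^ 'n" where
  "drop_x1 k z = (\<chi> j. if j = k then Complex 0 (Im (z $ k)) else z $ j)"

text \<open>In the next definitions \<open>D\<close> and \<open>f\<close> are already expressed in the adapted coordinates, so the
  boundary point is \<open>0\<close>.\<close>

definition graph_representation ::
    "'n \<Rightarrow> (complex ^ 'n) set \<Rightarrow> (complex ^ 'n \<Rightarrow> real) \<Rightarrow> (complex ^ 'n) set \<Rightarrow> bool" where
  "graph_representation k D \<psi> V \<longleftrightarrow>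
     open V \<and> bounded V \<and> 0 \<in> V \<and>
     \<psi> 0 = 0 \<and> ((\<lambda>z. \<psi> (drop_x1 k z)) has_derivative (\<lambda>_. 0)) (at 0) \<and>
     (\<exists>W. closure V \<subseteq> W \<and> C2_on (\<lambda>z. \<psi> (drop_x1 k z)) W \<and>
        D \<inter> W = {z \<in> W. Re (z $ k) > \<psi> (drop_x1 k z)} \<and>
        frontier D \<inter> W = {z \<in> W. Re (z $ k) = \<psi> (drop_x1 k z)})"

definition depth :: "'n \<Rightarrow> (complex ^ 'n \<Rightarrow> real) \<Rightarrow> complex ^ 'n \<Rightarrow> real" where
  "depth k \<psi> z = min (Re (z $ k)) (Re (z $ k) - \<psi> (drop_x1 k z))"

definition approach_region ::
    "'n \<Rightarrow> (complex ^ 'n) set \<Rightarrow> (complex ^ 'n \<Rightarrow> real) \<Rightarrow> (complex ^ 'n) set \<Rightarrow> real \<Rightarrow>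
     (complex ^ 'n) set" where
  "approach_region k D \<psi> V \<alpha> =
     {z \<in> D \<inter> V. (norm z)\<^sup>2 < \<alpha> * depth k \<psi> z \<and> \<bar>Im (z $ k)\<bar> < \<alpha> * Re (z $ k)}"

definition has_admissible_limit ::
    "'n \<Rightarrow> (complex ^ 'n) set \<Rightarrow> (complex ^ 'n \<Rightarrow> real) \<Rightarrow> (complex ^ 'n) set \<Rightarrow>
     (complex ^ 'n \<Rightarrow> complex) \<Rightarrow> extended_complex \<Rightarrow> bool" where
  "has_admissible_limit k D \<psi> V f L \<longleftrightarrow>
     (\<forall>\<alpha>>0. tends_to_extended f L (at 0 within approach_region k D \<psi> V \<alpha>))"

definition nabla ::
    "'n \<Rightarrow> (complex ^ 'n \<Rightarrow> real) \<Rightarrow> (complex ^ 'n \<Rightarrow> complex) \<Rightarrow> complex ^ 'n \<Rightarrow> real" where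
  "nabla k \<psi> f z =
     sqrt ((depth k \<psi> z)\<^sup>2 * (cmod (complex_partial k f z))\<^sup>2 +
           depth k \<psi> z * (\<Sum>j\<in>UNIV - {k}. (cmod (complex_partial j f z))\<^sup>2))"

end

theory Submission
  imports Defs "HOL-Complex_Analysis.Cauchy_Integral_Formula"
begin

text \<open>Around a point \<open>z\<close> of an approach region, the polydisc with radius comparable to \<open>d z\<close> in the
  distinguished direction and to \<open>sqrt (d z)\<close> in the others lies in a larger approach region. If \<open>f\<close>
  has an admissible limit, Cauchy's estimate on the axis discs of this polydisc, applied to \<open>f - L\<close> or
  to \<open>1 / f\<close>, shows that the spherical gradient tends to \<open>0\<close>. Conversely, \<open>z\<close> is joined to a point of
  the normal by a segment inside a larger approach region, whose length measured by the radii of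
  these polydiscs is bounded. Integrating the spherical gradient along it shows that the spherical
  distance between the values of \<open>f\<close> at the two ends tends to \<open>0\<close>.\<close>

section \<open>The Riemann sphere and its chordal distance\<close>

text \<open>Stereographic projection onto a sphere of radius \<open>1/2\<close> that passes through the origin, the
  image of \<open>\<infinity>\<close>. It is conformal with factor \<open>1 / (1 + |w|\<^sup>2)\<close>, the weight in the theorem.\<close>

definition stereo :: "complex \<Rightarrow> complex \<times> real" where
  "stereo w = inverse (1 + w \<bullet> w) *\<^sub>R (w, 1)"

primrec stereo_extended :: "extended_complex \<Rightarrow> complex \<times> real" where
  "stereo_extended (Finite l) = stereo l"
| "stereo_extended Infinity = 0"

lemma one_plus_inner_self_pos: "0 < 1 + w \<bullet> (w :: complex)"
  using inner_ge_zero[of w] by linarith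

lemma norm_stereo: "norm (stereo w) = inverse (sqrt (1 + w \<bullet> w))"
proof -
  have pos: "0 < 1 + w \<bullet> w" by (rule one_plus_inner_self_pos)
  have "norm (stereo w) = inverse (1 + w \<bullet> w) * sqrt (1 + w \<bullet> w)"
    unfolding stereo_def norm_scaleR using pos by (simp add: norm_Pair dot_square_norm add.commute)
  also have "\<dots> = inverse (sqrt (1 + w \<bullet> w))"
    using pos by (metis real_div_sqrt less_imp_le inverse_inverse_eq inverse_mult_distrib
      divide_inverse)
  finally show ?thesis .
qed

lemma has_derivative_stereo:
  "(stereo has_derivative
     (\<lambda>h. inverse (1 + w \<bullet> w) *\<^sub>R (h, 0) - (2 * (w \<bullet> h) / (1 + w \<bullet> w)\<^sup>2) *\<^sub>R (w, 1))) (at w)"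
  unfolding stereo_def [abs_def]
  using one_plus_inner_self_pos[of w]
  by (auto intro!: derivative_eq_intros ext
      simp: inner_commute power2_eq_square divide_simps algebra_simps)

lemma norm_derivative_stereo:
  fixes w h :: complex
  defines "q \<equiv> 1 + w \<bullet> w"
  shows "norm (inverse q *\<^sub>R (h, 0 :: real) - (2 * (w \<bullet> h) / q\<^sup>2) *\<^sub>R (w, 1)) = norm h / q"
proof -
  have q: "q > 0" unfolding q_def by (rule one_plus_inner_self_pos)
  define a where "a = 2 * (w \<bullet> h) / q\<^sup>2"
  have "(norm (inverse q *\<^sub>R (h, 0 :: real) - a *\<^sub>R (w, 1)))\<^sup>2
      = (h \<bullet> h) / q\<^sup>2 - 2 * a * (w \<bullet> h) / q + a\<^sup>2 * (w \<bullet> w + 1)"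
    unfolding power2_norm_eq_inner inner_diff_left inner_diff_right
    by (simp add: inner_commute power2_eq_square field_simps)
  \<comment> \<open>Since \<open>a * q = 2 * (w \<bullet> h) / q\<close>, the cross term and the
    quadratic term in \<open>a\<close> cancel.\<close>
  also have "\<dots> = (h \<bullet> h) / q\<^sup>2"
    unfolding a_def using q by (simp add: q_def[symmetric] add.commute[of _ 1] power2_eq_square field_simps)
  also have "\<dots> = (norm h / q)\<^sup>2" by (simp add: power_divide dot_square_norm)
  finally show ?thesis
    unfolding a_def using q by (simp add: power2_eq_iff_nonneg)
qed

text \<open>Near infinity \<open>stereo w\<close> has norm 1/sqrt(1 + |w|^2), and elsewhere
  \<open>stereo\<close> is continuous. With the converse below, finite and infinite limits become
  one ordinary limit in a normed space, where differences can be estimated.\<close>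

lemma tends_to_extended_stereo:
  assumes "tends_to_extended f L F"
  shows "((\<lambda>x. stereo (f x)) \<longlongrightarrow> stereo_extended L) F"
proof (cases L)
  case (Finite l)
  have "isCont stereo l"
    using has_derivative_stereo by (rule has_derivative_continuous)
  with assms Finite show ?thesis by (auto intro: isCont_tendsto_compose)
next
  case Infinity
  then have "LIM x F. 1 + (norm (f x))\<^sup>2 :> at_top"
    using assms
    by (auto intro!: filterlim_tendsto_add_at_top[OF tendsto_const] filterlim_pow_at_top
        simp: filterlim_at_infinity_conv_norm_at_top)
  then have "((\<lambda>x. inverse (sqrt (1 + (norm (f x))\<^sup>2))) \<longlongrightarrow> 0) F"
    by (intro tendsto_inverse_0_at_top filterlim_compose[OF sqrt_at_top])
  then have "((\<lambda>x. norm (stereo (f x))) \<longlongrightarrow> 0) F"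
    by (simp add: norm_stereo dot_square_norm)
  then show ?thesis
    using Infinity by (simp add: tendsto_norm_zero_iff)
qed

lemma tends_to_extended_if_stereo:
  assumes "((\<lambda>x. stereo (f x)) \<longlongrightarrow> stereo_extended L) F"
  shows "tends_to_extended f L F"
proof (cases L)
  case (Finite l)
  \<comment> \<open>This quotient inverts the projection and is continuous wherever the second
    component is nonzero, in particular at \<open>stereo l\<close>.\<close>
  have quot: "fst (stereo w) / complex_of_real (snd (stereo w)) = w" for w
    using one_plus_inner_self_pos[of w]
    by (simp add: stereo_def scaleR_conv_of_real flip: of_real_inverse)
  have "snd (stereo l) \<noteq> 0" using one_plus_inner_self_pos[of l] by (simp add: stereo_def)
  then have "((\<lambda>x. fst (stereo (f x)) / complex_of_real (snd (stereo (f x)))) \<longlongrightarrow>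
      fst (stereo l) / complex_of_real (snd (stereo l))) F"
    using assms Finite by (intro tendsto_intros) auto
  then show ?thesis using Finite by (simp add: quot)
next
  case Infinity
  have "\<forall>\<^sub>F x in F. B \<le> norm (f x)" for B
  proof -
    have "\<forall>\<^sub>F x in F. norm (stereo (f x)) < inverse (sqrt (1 + B\<^sup>2))"
      using assms Infinity by (auto simp: tendsto_iff dist_norm sum_power2_gt_zero_iff
          add_pos_nonneg)
    then show ?thesis
    proof eventually_elim
      case (elim x)
      then have "sqrt (1 + B\<^sup>2) < sqrt (1 + f x \<bullet> f x)"
        by (simp add: norm_stereo one_plus_inner_self_pos add_pos_nonneg)
      then have "B\<^sup>2 < (norm (f x))\<^sup>2" by (simp add: dot_square_norm)
      then show ?case using power2_less_imp_less norm_ge_zero less_imp_le by blast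
    qed
  qed
  then show ?thesis
    using Infinity by (simp add: filterlim_at_infinity_conv_norm_at_top filterlim_at_top)
qed

section \<open>Cauchy's estimate for the spherical derivative\<close>

text \<open>If \<phi> stays near \<open>l\<close>, the weight is at most 1 and Cauchy's estimate for
  \<phi> - l suffices. If \<phi> is large, the weight is at most 1/|\<phi>(0)|^2, and
  |\<phi>'(0)|/|\<phi>(0)|^2 is the modulus of the derivative of 1/\<phi>, which is bounded by
  \<eta>. Positivity of \<eta> in this alternative makes \<open>inverse \<eta>\<close> positive, so
  \<phi> has no zeros on the disc.\<close>

lemma spherical_derivative_bound:
  assumes holo: "\<phi> holomorphic_on S" and "open S" and "cball 0 r \<subseteq> S" and "0 < r"
    and "(\<forall>h\<in>cball 0 r. cmod (\<phi> h - l) \<le> \<eta>) \<or> (0 < \<eta> \<and> (\<forall>h\<in>cball 0 r. inverse \<eta> \<le> cmod (\<phi> h)))"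
  shows "inverse (1 + (cmod (\<phi> 0))\<^sup>2) * cmod (deriv \<phi> 0) \<le> \<eta> / r"
  using assms(5)
proof
  assume bd: "\<forall>h\<in>cball 0 r. cmod (\<phi> h - l) \<le> \<eta>"
  have "cmod ((deriv ^^ 1) \<phi> 0) \<le> fact 1 * \<eta> / r ^ 1"
  proof -
    have "\<phi> holomorphic_on cball 0 r" using holo assms(3) by (rule holomorphic_on_subset)
    then have h: "(\<lambda>h. \<phi> h - l) holomorphic_on cball 0 r" by (intro holomorphic_intros)
    have "cmod ((deriv ^^ 1) (\<lambda>h. \<phi> h - l) 0) \<le> fact 1 * \<eta> / r ^ 1"
      by (rule Cauchy_inequality)
        (use h bd assms(4) in \<open>auto intro: holomorphic_on_subset holomorphic_on_imp_continuous_on\<close>)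
    moreover have "\<phi> field_differentiable at 0"
      using holo assms(2-4) by (meson holomorphic_on_imp_differentiable_at centre_in_cball less_imp_le subsetD)
    ultimately show ?thesis by simp
  qed
  then have "cmod (deriv \<phi> 0) \<le> \<eta> / r" by simp
  moreover have "inverse (1 + (cmod (\<phi> 0))\<^sup>2) \<le> 1" by (simp add: inverse_le_1_iff)
  ultimately show ?thesis
    by (meson mult_left_le_one_le norm_ge_zero order_trans inverse_nonnegative_iff_nonnegative
        add_nonneg_nonneg zero_le_one zero_le_power2)
next
  assume bd: "0 < \<eta> \<and> (\<forall>h\<in>cball 0 r. inverse \<eta> \<le> cmod (\<phi> h))"
  then have nz: "\<phi> h \<noteq> 0" if "h \<in> cball 0 r" for h
    using that by (metis inverse_positive_iff_positive norm_zero not_le)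
  have h: "(\<lambda>h. inverse (\<phi> h)) holomorphic_on cball 0 r"
    using holo assms(3) nz by (auto intro!: holomorphic_intros intro: holomorphic_on_subset)
  have "cmod ((deriv ^^ 1) (\<lambda>h. inverse (\<phi> h)) 0) \<le> fact 1 * \<eta> / r ^ 1"
  proof (rule Cauchy_inequality)
    show "cmod (inverse (\<phi> x)) \<le> \<eta>" if "cmod (0 - x) = r" for x
    proof -
      have "inverse \<eta> \<le> cmod (\<phi> x)" using bd that by auto
      then have "inverse (cmod (\<phi> x)) \<le> inverse (inverse \<eta>)"
        using bd by (intro le_imp_inverse_le) auto
      then show ?thesis by (simp add: norm_inverse)
    qed
  qed (use h assms(4) in \<open>auto intro: holomorphic_on_subset holomorphic_on_imp_continuous_on\<close>)
  moreover have "\<phi> field_differentiable at 0"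
    using holo assms(2-4) by (meson holomorphic_on_imp_differentiable_at centre_in_cball less_imp_le subsetD)
  ultimately have "cmod (deriv \<phi> 0) / (cmod (\<phi> 0))\<^sup>2 \<le> \<eta> / r"
    using nz[of 0] assms(4) by (simp add: deriv_inverse norm_divide norm_power)
  moreover have "inverse (1 + (cmod (\<phi> 0))\<^sup>2) \<le> inverse ((cmod (\<phi> 0))\<^sup>2)"
    using nz[of 0] assms(4) by (intro le_imp_inverse_le) auto
  then have "inverse (1 + (cmod (\<phi> 0))\<^sup>2) * cmod (deriv \<phi> 0) \<le> cmod (deriv \<phi> 0) / (cmod (\<phi> 0))\<^sup>2"
    by (simp add: divide_inverse mult.commute mult_left_mono)
  ultimately show ?thesis by linarith
qed

section \<open>Holomorphic functions of several variables on coordinate slices\<close>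

lemma axis_eq_smult: "axis j h = h *s axis j (1 :: complex)"
  by (simp add: vec_eq_iff axis_def)

lemma norm_axis: "norm (axis j h :: 'a :: real_normed_vector ^ 'n) = norm h"
  by (simp add: norm_vec_def L2_set_def axis_def if_distrib[of norm]
      if_distrib[of "\<lambda>x. x\<^sup>2"] cong: if_cong)

lemma bounded_linear_axis: "bounded_linear (axis j :: 'a :: real_normed_vector \<Rightarrow> 'a ^ 'n)"
  by (rule bounded_linear_intro[where K = 1]) (auto simp: norm_axis vec_eq_iff, auto simp: axis_def)

lemma has_derivative_add_axis: "((\<lambda>h. z + axis j h) has_derivative axis j) (at h)"
  using has_derivative_add[OF has_derivative_const
      bounded_linear_imp_has_derivative[OF bounded_linear_axis]] by simp

lemma has_field_derivative_slice:
  fixes f :: "complex ^ 'n \<Rightarrow> complex"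
  assumes F: "(f has_derivative F) (at (z + axis j h))" and lin: "\<And>c v. F (c *s v) = c * F v"
  shows "((\<lambda>h. f (z + axis j h)) has_field_derivative F (axis j 1)) (at h)"
proof -
  have "((\<lambda>h. f (z + axis j h)) has_derivative (\<lambda>h. F (axis j h))) (at h)"
    using has_derivative_compose[OF has_derivative_add_axis F] .
  moreover have "(\<lambda>h. F (axis j h)) = (*) (F (axis j 1))"
    by (rule ext, subst axis_eq_smult) (simp add: lin)
  ultimately show ?thesis by (simp add: has_field_derivative_def)
qed

text \<open>A complex-linear derivative is determined by its values on the axis vectors, which are
  the complex partials. The chain rule along a real segment then involves exactly the quantities
  that enter \<open>nabla\<close>.\<close>

lemma holomorphic_Cn_on_derivative:
  fixes f :: "complex ^ 'n \<Rightarrow> complex"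
  assumes "holomorphic_Cn_on f D" and "z \<in> D"
  shows "(f has_derivative (\<lambda>v. \<Sum>j\<in>UNIV. v $ j * complex_partial j f z)) (at z)"
proof -
  obtain F where F: "(f has_derivative F) (at z)" and lin: "\<And>c v. F (c *s v) = c * F v"
    using assms unfolding holomorphic_Cn_on_def by blast
  have partial: "complex_partial j f z = F (axis j 1)" for j
  proof -
    have "z + axis j 0 = z" by (simp add: vec_eq_iff axis_def)
    with F have "(f has_derivative F) (at (z + axis j 0))" by metis
    then show ?thesis
      unfolding complex_partial_def by (intro DERIV_imp_deriv has_field_derivative_slice lin)
  qed
  have "F v = (\<Sum>j\<in>UNIV. v $ j * F (axis j 1))" for v
  proof -
    have "linear F" using F by (rule has_derivative_linear)
    then have "F (\<Sum>j\<in>UNIV. v $ j *s axis j 1) = (\<Sum>j\<in>UNIV. v $ j * F (axis j 1))"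
      by (simp add: linear_sum lin)
    then show ?thesis by (simp only: basis_expansion)
  qed
  then have "F = (\<lambda>v. \<Sum>j\<in>UNIV. v $ j * complex_partial j f z)"
    unfolding partial by (rule ext)
  with F show ?thesis by simp
qed

lemma holomorphic_Cn_on_slice:
  fixes f :: "complex ^ 'n \<Rightarrow> complex"
  assumes "holomorphic_Cn_on f D"
  shows "open {h. z + axis j h \<in> D}"
    and "(\<lambda>h. f (z + axis j h)) holomorphic_on {h. z + axis j h \<in> D}"
proof -
  have "continuous_on UNIV (\<lambda>h. z + axis j h)"
    using has_derivative_at_withinI[OF has_derivative_add_axis] by (rule has_derivative_continuous_on)
  then show op: "open {h. z + axis j h \<in> D}"
    using assms unfolding holomorphic_Cn_on_def
    by (simp add: continuous_on_open_vimage vimage_def)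
  show "(\<lambda>h. f (z + axis j h)) holomorphic_on {h. z + axis j h \<in> D}"
    unfolding holomorphic_on_open[OF op]
  proof (intro ballI)
    fix h assume "h \<in> {h. z + axis j h \<in> D}"
    then obtain F where "(f has_derivative F) (at (z + axis j h))" "\<And>c v. F (c *s v) = c * F v"
      using assms unfolding holomorphic_Cn_on_def by blast
    then have "((\<lambda>h. f (z + axis j h)) has_field_derivative F (axis j 1)) (at h)"
      by (rule has_field_derivative_slice)
    then show "\<exists>f'. ((\<lambda>h. f (z + axis j h)) has_field_derivative f') (at h)" ..
  qed
qed

section \<open>The gradient in units of the polydisc radii\<close>

text \<open>The natural scale in an approach region: where |z| is O(sqrt d), the gradient of \<psi>
  is O(sqrt d) as well, so a tangential move of size sqrt d changes \<psi> by only O(d).\<close>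

definition polyradius :: "'n \<Rightarrow> (complex ^ 'n \<Rightarrow> real) \<Rightarrow> complex ^ 'n \<Rightarrow> 'n \<Rightarrow> real" where
  "polyradius k \<psi> z j = (if j = k then depth k \<psi> z else sqrt (depth k \<psi> z))"

lemma polyradius_nonneg: "0 \<le> depth k \<psi> z \<Longrightarrow> 0 \<le> polyradius k \<psi> z j"
  by (simp add: polyradius_def)

lemma nabla_eq_L2_set:
  assumes "0 \<le> depth k \<psi> z"
  shows "nabla k \<psi> f z = L2_set (\<lambda>j. polyradius k \<psi> z j * cmod (complex_partial j f z)) UNIV"
  unfolding nabla_def L2_set_def using assms
  by (subst sum.remove[of UNIV k])
    (auto simp: polyradius_def power_mult_distrib sum_distrib_left intro!: sum.cong)

lemma norm_partial_le_nabla: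
  assumes "0 \<le> depth k \<psi> z"
  shows "polyradius k \<psi> z j * cmod (complex_partial j f z) \<le> nabla k \<psi> f z"
  unfolding nabla_eq_L2_set[OF assms] by (rule member_le_L2_set) auto

lemma nabla_le_sum:
  assumes "0 \<le> depth k \<psi> z"
  shows "nabla k \<psi> f z \<le> (\<Sum>j\<in>UNIV. polyradius k \<psi> z j * cmod (complex_partial j f z))"
  unfolding nabla_eq_L2_set[OF assms]
  by (rule L2_set_le_sum) (simp add: polyradius_nonneg assms)

section \<open>Approach regions in adapted coordinates\<close>

text \<open>\<open>psi_diff\<close> is the integrated form of a gradient bound O(|z|), as holds for
  a C^2 function whose gradient vanishes at 0. With \<open>y = 0\<close> it gives |\<psi>| \<le> K
  |z|^2.\<close>

locale adapted_graph =
  fixes k :: "'n :: finite" and D V :: "(complex ^ 'n) set" and \<psi> :: "complex ^ 'n \<Rightarrow> real"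
    and K r :: real
  assumes K_nonneg: "0 \<le> K" and r_pos: "0 < r" and ball_subset: "ball 0 r \<subseteq> V"
    and mem_D_iff: "\<And>z. norm z < r \<Longrightarrow> z \<in> D \<longleftrightarrow> Re (z $ k) > \<psi> (drop_x1 k z)"
    and psi_zero: "\<psi> 0 = 0"
    and psi_diff: "\<And>x y. norm x < r \<Longrightarrow> norm y < r \<Longrightarrow>
      \<bar>\<psi> (drop_x1 k x) - \<psi> (drop_x1 k y)\<bar> \<le> K * (norm x + norm y) * norm (x - y)"
begin

abbreviation "d \<equiv> depth k \<psi>"
abbreviation "A \<equiv> approach_region k D \<psi> V"

lemma A_I:
  assumes "norm z < r" and "0 < d z" and "(norm z)\<^sup>2 < \<alpha> * d z" and "\<bar>Im (z $ k)\<bar> < \<alpha> * Re (z $ k)"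
  shows "z \<in> A \<alpha>"
  using assms ball_subset mem_D_iff[of z] unfolding approach_region_def by (auto simp: depth_def)

lemma A_D:
  assumes "z \<in> A \<alpha>" and "0 < \<alpha>"
  shows "z \<in> D" and "0 < d z" and "(norm z)\<^sup>2 < \<alpha> * d z" and "\<bar>Im (z $ k)\<bar> < \<alpha> * Re (z $ k)"
    and "d z \<le> Re (z $ k)" and "d z \<le> norm z" and "Re (z $ k) \<le> norm z"
proof -
  show "z \<in> D" "\<bar>Im (z $ k)\<bar> < \<alpha> * Re (z $ k)" and *: "(norm z)\<^sup>2 < \<alpha> * d z"
    using assms unfolding approach_region_def by auto
  from * have "0 < \<alpha> * d z" by (meson le_less_trans zero_le_power2)
  then show "0 < d z" using assms(2) by (simp add: zero_less_mult_iff)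
  show **: "d z \<le> Re (z $ k)" by (simp add: depth_def)
  show ***: "Re (z $ k) \<le> norm z"
    using complex_Re_le_cmod[of "z $ k"] Finite_Cartesian_Product.norm_nth_le[of z k] by linarith
  show "d z \<le> norm z" using ** *** by linarith
qed

text \<open>Here |\<psi>| \<le> K |z|^2 \<le> K \<alpha> d, so height and depth are comparable. This
  is what turns bounds by the height into bounds by the normal polyradius.\<close>

lemma Re_le_depth:
  assumes "z \<in> A \<alpha>" and "0 < \<alpha>" and "norm z < r"
  shows "Re (z $ k) \<le> (1 + K * \<alpha>) * d z"
proof -
  have "drop_x1 k 0 = 0" by (simp add: drop_x1_def vec_eq_iff complex_eq_iff)
  then have "\<bar>\<psi> (drop_x1 k z)\<bar> \<le> K * (norm z * norm z)"
    using psi_diff[of z 0] assms(3) r_pos by (simp add: psi_zero mult.assoc)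
  also have "\<dots> \<le> K * (\<alpha> * d z)"
    using A_D(3)[OF assms(1,2)] K_nonneg by (intro mult_left_mono) (auto simp: power2_eq_square)
  finally have "\<bar>\<psi> (drop_x1 k z)\<bar> \<le> K * \<alpha> * d z" by simp
  moreover have "0 \<le> K * \<alpha> * d z" using K_nonneg assms A_D(2)[OF assms(1,2)] by simp
  moreover have "d z = Re (z $ k) \<or> d z = Re (z $ k) - \<psi> (drop_x1 k z)" by (auto simp: depth_def)
  ultimately show ?thesis by (auto simp: distrib_right)
qed

section \<open>From the gradient condition to the admissible limit\<close>

text \<open>The endpoint of the segment lies higher than \<open>z\<close> because the straight segment from \<open>z\<close> to its
  projection onto the normal may leave \<open>D\<close>; the gain \<open>2 * K * \<alpha>\<close> in height outweighs the
  variation of \<open>\<psi>\<close>.\<close>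

definition foot :: "real \<Rightarrow> complex ^ 'n \<Rightarrow> complex ^ 'n" where
  "foot \<alpha> z = ((1 + 2 * K * \<alpha>) * Re (z $ k)) *\<^sub>R axis k 1"

text \<open>With \<open>M = 2 * K * \<alpha>\<close>, the point at parameter \<open>s\<close> has
  gained height \<open>s * M * x\<close>, while \<psi> has grown by at most K (2|z|)(s|z|) \<le> s M
  x; hence the depth never falls below its initial value. The norm grows at most by the factor 2 +
  M, so the aperture needs the square of that factor.\<close>

lemma segment_to_foot:
  assumes z: "z \<in> A \<alpha>" and \<alpha>: "0 < \<alpha>" and small: "(2 + 2 * K * \<alpha>) * norm z < r"
    and s: "0 \<le> s" "s \<le> 1"
  defines "w \<equiv> z + s *\<^sub>R (foot \<alpha> z - z)"
  shows "w \<in> A ((2 + 2 * K * \<alpha>)\<^sup>2 * \<alpha>)" and "d z \<le> d w"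
    and "norm w \<le> (2 + 2 * K * \<alpha>) * norm z"
proof -
  define M where "M = 2 * K * \<alpha>"
  have M: "0 \<le> M" using K_nonneg \<alpha> by (simp add: M_def)
  note zD = A_D[OF z \<alpha>]
  define x where "x = Re (z $ k)"
  have x: "0 < x" using zD x_def by linarith
  have wk: "Re (w $ k) = x * (1 + s * M)" "Im (w $ k) = (1 - s) * Im (z $ k)"
    by (simp_all add: w_def foot_def x_def M_def algebra_simps)
  have nw: "norm w \<le> (2 + M) * norm z"
  proof -
    have "norm w = norm ((1 - s) *\<^sub>R z + s *\<^sub>R foot \<alpha> z)" by (simp add: w_def algebra_simps)
    also have "\<dots> \<le> (1 - s) * norm z + s * norm (foot \<alpha> z)"
      using s by (metis abs_of_nonneg diff_ge_0_iff_ge norm_scaleR norm_triangle_ineq)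
    also have "norm (foot \<alpha> z) = (1 + M) * x"
      using x M by (simp add: foot_def M_def x_def norm_axis)
    also have "(1 - s) * norm z + s * ((1 + M) * x) \<le> 1 * norm z + 1 * ((1 + M) * norm z)"
      using s M x zD(7) by (intro add_mono mult_mono) (auto simp: x_def)
    finally show ?thesis by (simp add: algebra_simps)
  qed
  then show "norm w \<le> (2 + 2 * K * \<alpha>) * norm z" by (simp add: M_def)
  have nz: "norm z < r"
    using small M mult_right_mono[of 1 "2 + M" "norm z"] by (simp add: M_def)
  \<comment> \<open>The foot has a real distinguished coordinate and no others, so
    \<open>drop_x1\<close> kills it and \<psi> sees only the shrunken point
    \<open>(1 - s) *\<^sub>R z\<close>.\<close>
  have drop: "drop_x1 k w = drop_x1 k ((1 - s) *\<^sub>R z)"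
    by (simp add: w_def foot_def drop_x1_def vec_eq_iff axis_def algebra_simps)
  have "\<bar>\<psi> (drop_x1 k ((1 - s) *\<^sub>R z)) - \<psi> (drop_x1 k z)\<bar>
      \<le> K * (norm ((1 - s) *\<^sub>R z) + norm z) * norm ((1 - s) *\<^sub>R z - z)"
    using nz s mult_left_le_one_le[of "norm z" "1 - s"] by (intro psi_diff) auto
  also have "\<dots> \<le> K * (norm z + norm z) * (s * norm z)"
  proof -
    have "(1 - s) *\<^sub>R z - z = - (s *\<^sub>R z)" by (simp add: algebra_simps)
    then show ?thesis
      using s K_nonneg by (intro mult_mono add_mono) (auto simp: mult_left_le_one_le)
  qed
  also have "\<dots> = (2 * K * s) * (norm z)\<^sup>2" by (simp add: power2_eq_square)
  also have "\<dots> \<le> (2 * K * s) * (\<alpha> * x)"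
  proof (rule mult_left_mono)
    have "\<alpha> * d z \<le> \<alpha> * x" using zD \<alpha> by (simp add: x_def)
    then show "(norm z)\<^sup>2 \<le> \<alpha> * x" using zD by linarith
  qed (use K_nonneg s in auto)
  finally have psi: "\<psi> (drop_x1 k w) \<le> \<psi> (drop_x1 k z) + s * M * x"
    by (simp add: drop M_def mult_ac)
  have "0 \<le> s * M * x" using s M x by simp
  then show dw: "d z \<le> d w"
    using psi wk(1) by (auto simp: depth_def min_def x_def algebra_simps)
  show "w \<in> A ((2 + 2 * K * \<alpha>)\<^sup>2 * \<alpha>)"
  proof (rule A_I)
    show "norm w < r" using nw small by (simp add: M_def)
    show "0 < d w" using dw zD by linarith
    have "(norm w)\<^sup>2 \<le> ((2 + M) * norm z)\<^sup>2" using nw by (simp add: power_mono)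
    also have "\<dots> < (2 + M)\<^sup>2 * (\<alpha> * d z)"
      unfolding power_mult_distrib using M zD by (intro mult_strict_left_mono) auto
    also have "\<dots> \<le> (2 + M)\<^sup>2 * (\<alpha> * d w)"
      using dw \<alpha> by (intro mult_left_mono) auto
    finally show "(norm w)\<^sup>2 < (2 + 2 * K * \<alpha>)\<^sup>2 * \<alpha> * d w" by (simp add: M_def mult.assoc)
    have "\<bar>Im (w $ k)\<bar> \<le> \<bar>Im (z $ k)\<bar>"
      using s by (simp add: wk abs_mult mult_left_le_one_le)
    also have "\<dots> < \<alpha> * x" using zD by (simp add: x_def)
    also have "\<dots> \<le> \<alpha> * Re (w $ k)"
      using \<alpha> x s M by (simp add: wk)
    also have "\<dots> \<le> (2 + M)\<^sup>2 * (\<alpha> * Re (w $ k))"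
      using \<alpha> x s M mult_right_mono[of 1 "(2 + M)\<^sup>2" "\<alpha> * Re (w $ k)"] by (simp add: wk)
    finally show "\<bar>Im (w $ k)\<bar> < (2 + 2 * K * \<alpha>)\<^sup>2 * \<alpha> * Re (w $ k)" by (simp add: M_def mult.assoc)
  qed
qed

text \<open>The normal component is at most a multiple of the height, which
  \<open>Re_le_depth\<close> compares with d; the tangential ones are at most |z| < sqrt(\<alpha>
  d). The constant serves both cases and does not depend on \<open>z\<close>.\<close>

lemma foot_diff_le_polyradius:
  assumes z: "z \<in> A \<alpha>" and \<alpha>: "0 < \<alpha>" and small: "norm z < r"
  shows "cmod ((foot \<alpha> z - z) $ j) \<le> ((2 * K * \<alpha> + \<alpha>) * (1 + K * \<alpha>) + sqrt \<alpha>) * polyradius k \<psi> z j"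
proof (cases "j = k")
  case True
  note zD = A_D[OF z \<alpha>]
  have x: "0 < Re (z $ k)" using zD by linarith
  have nonneg: "0 \<le> K * \<alpha>" using K_nonneg \<alpha> by simp
  have "(foot \<alpha> z - z) $ k = Complex (2 * K * \<alpha> * Re (z $ k)) (- Im (z $ k))"
    by (simp add: foot_def complex_eq_iff algebra_simps)
  then have "cmod ((foot \<alpha> z - z) $ k) \<le> \<bar>2 * K * \<alpha> * Re (z $ k)\<bar> + \<bar>Im (z $ k)\<bar>"
    using cmod_le[of "(foot \<alpha> z - z) $ k"] by simp
  also have "\<dots> \<le> 2 * K * \<alpha> * Re (z $ k) + \<alpha> * Re (z $ k)"
    using zD nonneg x by (simp add: abs_mult K_nonneg \<alpha> less_imp_le)
  also have "\<dots> = (2 * K * \<alpha> + \<alpha>) * Re (z $ k)" by (simp add: algebra_simps)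
  also have "\<dots> \<le> (2 * K * \<alpha> + \<alpha>) * ((1 + K * \<alpha>) * d z)"
    using Re_le_depth[OF z \<alpha> small] nonneg \<alpha> by (intro mult_left_mono) auto
  also have "\<dots> \<le> ((2 * K * \<alpha> + \<alpha>) * (1 + K * \<alpha>) + sqrt \<alpha>) * d z"
    using zD \<alpha> by (simp add: distrib_right mult.assoc)
  finally show ?thesis by (simp add: True polyradius_def)
next
  case False
  note zD = A_D[OF z \<alpha>]
  have "cmod ((foot \<alpha> z - z) $ j) \<le> norm z"
    using False by (simp add: foot_def axis_def Finite_Cartesian_Product.norm_nth_le)
  also have "\<dots> \<le> sqrt (\<alpha> * d z)" using zD by (intro real_le_rsqrt) simp
  also have "\<dots> \<le> ((2 * K * \<alpha> + \<alpha>) * (1 + K * \<alpha>) + sqrt \<alpha>) * sqrt (d z)"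
    using zD \<alpha> K_nonneg by (simp add: real_sqrt_mult distrib_right)
  finally show ?thesis using False by (simp add: polyradius_def)
qed

text \<open>By conformality the speed of \<open>stereo (f (w s))\<close> is the modulus of the
  derivative of f along the segment divided by 1 + |f|^2. Each of the n coordinates contributes at
  most a constant times the weighted \<open>nabla\<close>, and the mean value inequality bounds the
  chord.\<close>

lemma stereo_foot_bound:
  assumes holo: "holomorphic_Cn_on f D" and z: "z \<in> A \<alpha>" and \<alpha>: "0 < \<alpha>"
    and small: "(2 + 2 * K * \<alpha>) * norm z < r"
    and grad: "\<And>w. w \<in> A ((2 + 2 * K * \<alpha>)\<^sup>2 * \<alpha>) \<Longrightarrow> norm w \<le> (2 + 2 * K * \<alpha>) * norm z \<Longrightarrow>
      inverse (1 + (cmod (f w))\<^sup>2) * nabla k \<psi> f w \<le> e"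
  shows "norm (stereo (f (foot \<alpha> z)) - stereo (f z))
    \<le> real CARD('n) * ((2 * K * \<alpha> + \<alpha>) * (1 + K * \<alpha>) + sqrt \<alpha>) * e"
proof -
  define C where "C = (2 * K * \<alpha> + \<alpha>) * (1 + K * \<alpha>) + sqrt \<alpha>"
  define v where "v = foot \<alpha> z - z"
  define w where "w = (\<lambda>s. z + s *\<^sub>R v)"
  define F where "F = (\<lambda>s. \<Sum>j\<in>UNIV. v $ j * complex_partial j f (w s))"
  \<comment> \<open>The derivative of \<open>stereo\<close> at \<open>f (w s)\<close> applied to
    \<open>F s\<close>, in the form of \<open>norm_derivative_stereo\<close>.\<close>
  define G where "G = (\<lambda>s. inverse (1 + f (w s) \<bullet> f (w s)) *\<^sub>R (F s, 0 :: real)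
    - (2 * (f (w s) \<bullet> F s) / (1 + f (w s) \<bullet> f (w s))\<^sup>2) *\<^sub>R (f (w s), 1))"
  have "0 \<le> K * \<alpha>" using K_nonneg \<alpha> by simp
  then have C: "0 \<le> C" and nz: "norm z < r"
    using \<alpha> small mult_right_mono[of 1 "2 + 2 * K * \<alpha>" "norm z"] by (simp_all add: C_def)
  note zD = A_D[OF z \<alpha>]
  have seg: "w s \<in> A ((2 + 2 * K * \<alpha>)\<^sup>2 * \<alpha>)" "d z \<le> d (w s)"
      "norm (w s) \<le> (2 + 2 * K * \<alpha>) * norm z" if "0 \<le> s" "s \<le> 1" for s
    using segment_to_foot[OF z \<alpha> small that] by (simp_all add: w_def v_def)
  have wD: "w s \<in> D" if "0 \<le> s" "s \<le> 1" for s
    using seg(1)[OF that] by (simp add: approach_region_def)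
  have deriv: "((\<lambda>s. stereo (f (w s))) has_derivative (\<lambda>t. t *\<^sub>R G s)) (at s)"
    if "0 \<le> s" "s \<le> 1" for s
  proof -
    have "(w has_derivative (\<lambda>t. t *\<^sub>R v)) (at s)"
      unfolding w_def by (auto intro!: derivative_eq_intros)
    from has_derivative_compose[OF this holomorphic_Cn_on_derivative[OF holo wD[OF that]]]
    have "((\<lambda>s. f (w s)) has_derivative (\<lambda>t. t *\<^sub>R F s)) (at s)"
      by (simp add: F_def scaleR_sum_right)
    from has_derivative_compose[OF this has_derivative_stereo]
    show ?thesis by (rule has_derivative_eq_rhs) (simp add: G_def fun_eq_iff algebra_simps)
  qed
  have bound: "norm (G s) \<le> real CARD('n) * C * e" if s: "0 \<le> s" "s \<le> 1" for s
  proof -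
    define q where "q = inverse (1 + (cmod (f (w s)))\<^sup>2)"
    have q: "0 \<le> q" by (simp add: q_def)
    have dw: "0 \<le> d (w s)" using seg(2)[OF s] zD by linarith
    have "cmod (F s) \<le> (\<Sum>j\<in>UNIV. cmod (v $ j) * cmod (complex_partial j f (w s)))"
      unfolding F_def by (rule order_trans[OF norm_sum]) (simp add: norm_mult)
    also have "\<dots> \<le> (\<Sum>j\<in>(UNIV :: 'n set). C * nabla k \<psi> f (w s))"
    proof (rule sum_mono)
      fix j
      have "cmod (v $ j) \<le> C * polyradius k \<psi> z j"
        using foot_diff_le_polyradius[OF z \<alpha> nz] by (simp add: v_def C_def)
      \<comment> \<open>The displacement is measured by the radii at \<open>z\<close>, but
        \<open>nabla\<close> uses those at \<open>w s\<close>; the depth at \<open>w s\<close> is at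
        least that at \<open>z\<close>.\<close>
      also have "\<dots> \<le> C * polyradius k \<psi> (w s) j"
        using seg(2)[OF s] C by (intro mult_left_mono) (auto simp: polyradius_def)
      finally have "cmod (v $ j) * cmod (complex_partial j f (w s))
          \<le> C * (polyradius k \<psi> (w s) j * cmod (complex_partial j f (w s)))"
        by (simp add: mult_right_mono flip: mult.assoc)
      also have "\<dots> \<le> C * nabla k \<psi> f (w s)"
        by (intro mult_left_mono norm_partial_le_nabla dw C)
      finally show "cmod (v $ j) * cmod (complex_partial j f (w s)) \<le> C * nabla k \<psi> f (w s)" .
    qed
    finally have F: "cmod (F s) \<le> real CARD('n) * C * nabla k \<psi> f (w s)" by simp
    have "norm (G s) = q * cmod (F s)"
      unfolding G_def norm_derivative_stereo by (simp add: q_def dot_square_norm divide_inverse)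
    also have "\<dots> \<le> q * (real CARD('n) * C * nabla k \<psi> f (w s))"
      by (intro mult_left_mono F q)
    also have "\<dots> = real CARD('n) * C * (q * nabla k \<psi> f (w s))" by simp
    also have "\<dots> \<le> real CARD('n) * C * e"
      using grad[OF seg(1,3)[OF s]] C by (intro mult_left_mono) (auto simp: q_def)
    finally show ?thesis .
  qed
  have "\<exists>s\<in>{0<..<1}. norm (stereo (f (w 1)) - stereo (f (w 0))) \<le> norm ((1 - 0) *\<^sub>R G s)"
  proof (rule mvt_general[OF zero_less_one])
    show "continuous_on {0..1} (\<lambda>s. stereo (f (w s)))"
      using deriv by (intro continuous_at_imp_continuous_on ballI has_derivative_continuous) auto
  qed (use deriv in auto)
  then obtain s where "0 < s" "s < 1" "norm (stereo (f (w 1)) - stereo (f (w 0))) \<le> norm (G s)"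
    by auto
  with bound[of s] show ?thesis by (simp add: w_def v_def C_def)
qed

text \<open>The function is the coefficient of \<open>foot \<alpha> z\<close> on the normal, so the
  limit along the normal can be composed with it.\<close>

lemma A_tendsto_foot:
  assumes "0 < \<alpha>"
  shows "LIM z at 0 within A \<alpha>. (1 + 2 * K * \<alpha>) * Re (z $ k) :> at_right 0"
  unfolding filterlim_at
proof
  have "0 \<le> K * \<alpha>" using K_nonneg assms by simp
  have "0 < (1 + 2 * K * \<alpha>) * Re (z $ k)" if "z \<in> A \<alpha>" for z
    using A_D(2,5)[OF that assms] \<open>0 \<le> K * \<alpha>\<close> by (intro mult_pos_pos) auto
  moreover have "\<forall>\<^sub>F z in at 0 within A \<alpha>. z \<in> A \<alpha>" by (simp add: eventually_at_filter)
  ultimately show "\<forall>\<^sub>F z in at 0 within A \<alpha>. (1 + 2 * K * \<alpha>) * Re (z $ k) \<in> {0<..}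
      \<and> (1 + 2 * K * \<alpha>) * Re (z $ k) \<noteq> 0"
    unfolding greaterThan_iff by (metis (mono_tags, lifting) eventually_mono less_irrefl)
  show "((\<lambda>z. (1 + 2 * K * \<alpha>) * Re (z $ k)) \<longlongrightarrow> 0) (at 0 within A \<alpha>)"
    by (auto intro!: tendsto_eq_intros)
qed

text \<open>The feet run down the normal, where f tends to \<open>L\<close>, and the chordal
  distance between the values at \<open>z\<close> and at its foot tends to 0.\<close>

lemma admissible_limit_if_nabla:
  assumes holo: "holomorphic_Cn_on f D"
    and normal: "tends_to_extended (\<lambda>t::real. f (t *\<^sub>R axis k 1)) L (at_right 0)"
    and nabla: "\<And>\<alpha>. 0 < \<alpha> \<Longrightarrow>
      ((\<lambda>z. inverse (1 + (cmod (f z))\<^sup>2) * nabla k \<psi> f z) \<longlongrightarrow> 0) (at 0 within A \<alpha>)"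
  shows "has_admissible_limit k D \<psi> V f L"
  unfolding has_admissible_limit_def
proof (intro allI impI tends_to_extended_if_stereo)
  fix \<alpha> :: real assume \<alpha>: "0 < \<alpha>"
  define C where "C = (2 * K * \<alpha> + \<alpha>) * (1 + K * \<alpha>) + sqrt \<alpha>"
  define N where "N = 2 + 2 * K * \<alpha>"
  have "0 \<le> K * \<alpha>" using K_nonneg \<alpha> by simp
  then have C: "0 < C" and N: "2 \<le> N" using \<alpha> by (auto simp: C_def N_def intro!: add_nonneg_pos)
  have "((\<lambda>z. stereo (f (foot \<alpha> z)) - stereo (f z)) \<longlongrightarrow> 0) (at 0 within A \<alpha>)"
  proof (rule tendstoI)
    fix e :: real assume e: "0 < e"
    define e' where "e' = e / (2 * (real CARD('n) * C))"
    have e': "0 < e'" using e C by (simp add: e'_def)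
    have "0 < N\<^sup>2 * \<alpha>" using N \<alpha> by simp
    then obtain \<delta> where \<delta>: "0 < \<delta>" and grad: "\<And>w. w \<in> A (N\<^sup>2 * \<alpha>) \<Longrightarrow> w \<noteq> 0 \<Longrightarrow> norm w < \<delta> \<Longrightarrow>
        \<bar>inverse (1 + (cmod (f w))\<^sup>2) * nabla k \<psi> f w\<bar> < e'"
      using tendstoD[OF nabla e', of "N\<^sup>2 * \<alpha>"] unfolding eventually_at by auto
    show "\<forall>\<^sub>F z in at 0 within A \<alpha>. dist (stereo (f (foot \<alpha> z)) - stereo (f z)) 0 < e"
      unfolding eventually_at
    proof (intro exI conjI ballI impI)
      \<comment> \<open>Points of the segment have norm at most \<open>N * norm z\<close>, so all of
        it stays within both \<delta> and \<open>r\<close>.\<close>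
      show "0 < min \<delta> r / N" using \<delta> r_pos N by simp
      fix z assume z: "z \<in> A \<alpha>" and "z \<noteq> 0 \<and> dist z 0 < min \<delta> r / N"
      then have small: "N * norm z < \<delta>" "N * norm z < r" using N by (auto simp: field_simps)
      have "norm (stereo (f (foot \<alpha> z)) - stereo (f z)) \<le> real CARD('n) * C * e'"
        unfolding C_def
      proof (rule stereo_foot_bound[OF holo z \<alpha>])
        show "(2 + 2 * K * \<alpha>) * norm z < r" using small by (simp add: N_def)
        fix w assume w: "w \<in> A ((2 + 2 * K * \<alpha>)\<^sup>2 * \<alpha>)" "norm w \<le> (2 + 2 * K * \<alpha>) * norm z"
        then have "w \<in> A (N\<^sup>2 * \<alpha>)" "norm w < \<delta>" using small by (auto simp: N_def)
        moreover have "w \<noteq> 0" using A_D(2,6)[OF \<open>w \<in> A (N\<^sup>2 * \<alpha>)\<close> \<open>0 < N\<^sup>2 * \<alpha>\<close>] by auto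
        ultimately show "inverse (1 + (cmod (f w))\<^sup>2) * nabla k \<psi> f w \<le> e'"
          using grad[of w] by simp
      qed
      also have "\<dots> < e" using e C by (simp add: e'_def)
      finally show "dist (stereo (f (foot \<alpha> z)) - stereo (f z)) 0 < e" by simp
    qed
  qed
  moreover have "((\<lambda>z. stereo (f (foot \<alpha> z))) \<longlongrightarrow> stereo_extended L) (at 0 within A \<alpha>)"
    unfolding foot_def
    using filterlim_compose[OF tends_to_extended_stereo[OF normal] A_tendsto_foot[OF \<alpha>]] by simp
  ultimately show "((\<lambda>z. stereo (f z)) \<longlongrightarrow> stereo_extended L) (at 0 within A \<alpha>)"
    using tendsto_diff by fastforce
qed

section \<open>From the admissible limit to the gradient condition\<close>

text \<open>A move of length at most c sqrt d, starting where |z| \<le> sqrt(\<alpha> d), changes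
  \<psi> by at most K (2 sqrt \<alpha> + 1) c d and the height by at most c d. For small c the depth
  is at worst halved. The norm bound lets the discs shrink to 0 together with
  \<open>z\<close>.\<close>

lemma axis_disc_in_A:
  assumes \<alpha>: "0 < \<alpha>"
  obtains c where "0 < c" and "\<And>z j h. z \<in> A \<alpha> \<Longrightarrow> norm z \<le> 1 \<Longrightarrow> norm z + sqrt (norm z) < r \<Longrightarrow>
    cmod h \<le> c * polyradius k \<psi> z j \<Longrightarrow>
    z + axis j h \<in> A (4 * \<alpha> + 4) \<and> norm (z + axis j h) \<le> norm z + sqrt (norm z)"
proof
  \<comment> \<open>\<open>B * c * d z\<close> is the total possible loss of depth; \<open>c\<close>
    makes it \<open>d z / 2\<close>.\<close>
  define B where "B = 1 + K * (2 * sqrt \<alpha> + 1)"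
  define c where "c = 1 / (2 * B)"
  have B: "1 \<le> B" using K_nonneg \<alpha> by (simp add: B_def)
  then show c: "0 < c" by (simp add: c_def)
  have c_le: "c \<le> 1 / 2" and Bc: "B * c = 1 / 2" using B by (auto simp: c_def field_simps)
  fix z j h assume z: "z \<in> A \<alpha>" and z1: "norm z \<le> 1" and small: "norm z + sqrt (norm z) < r"
    and h: "cmod h \<le> c * polyradius k \<psi> z j"
  note zD = A_D[OF z \<alpha>]
  define w where "w = z + axis j h"
  \<comment> \<open>As d \<le> |z| \<le> 1, the normal disc is also no larger than c sqrt d.\<close>
  have d1: "d z \<le> sqrt (d z)" using zD z1 by (intro real_le_rsqrt) (simp add: power2_eq_square mult_left_le_one_le)
  have hs: "cmod h \<le> c * sqrt (d z)"
    using h d1 c by (auto simp: polyradius_def split: if_splits intro: order_trans mult_left_mono)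
  have cs: "c * sqrt (d z) \<le> 1 * sqrt (d z)" using c_le zD by (intro mult_right_mono) auto
  have wz: "norm (w - z) \<le> c * sqrt (d z)" using hs by (simp add: w_def norm_axis)
  have nw: "norm w \<le> norm z + c * sqrt (d z)"
    using norm_triangle_ineq[of z "axis j h"] hs by (simp add: w_def norm_axis)
  have ds: "sqrt (d z) \<le> sqrt (norm z)" using zD by simp
  then have nw': "norm w \<le> norm z + sqrt (norm z)" using nw cs by linarith
  have wk: "cmod (w $ k - z $ k) \<le> c * d z"
  proof (cases "j = k")
    case True with h show ?thesis by (simp add: w_def polyradius_def)
  next
    case False with c zD show ?thesis by (simp add: w_def axis_def)
  qed
  have Re: "\<bar>Re (w $ k) - Re (z $ k)\<bar> \<le> c * d z" and Im: "\<bar>Im (w $ k) - Im (z $ k)\<bar> \<le> c * d z"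
    using wk abs_Re_le_cmod[of "w $ k - z $ k"] abs_Im_le_cmod[of "w $ k - z $ k"] by auto
  have sq: "norm z \<le> sqrt \<alpha> * sqrt (d z)"
    using zD by (simp add: real_le_rsqrt flip: real_sqrt_mult)
  have "\<bar>\<psi> (drop_x1 k w) - \<psi> (drop_x1 k z)\<bar> \<le> K * (norm w + norm z) * norm (w - z)"
    using small nw' by (intro psi_diff) (auto intro: le_less_trans[OF _ small])
  also have "\<dots> \<le> K * ((2 * sqrt \<alpha> + 1) * sqrt (d z)) * (c * sqrt (d z))"
  proof -
    have "norm w + norm z \<le> (2 * sqrt \<alpha> + 1) * sqrt (d z)"
      using nw cs sq by (simp add: algebra_simps)
    then show ?thesis
      using wz K_nonneg zD \<alpha> by (intro mult_mono) auto
  qed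
  also have "\<dots> = K * (2 * sqrt \<alpha> + 1) * c * (sqrt (d z) * sqrt (d z))" by (simp only: mult_ac)
  also have "\<dots> = K * (2 * sqrt \<alpha> + 1) * c * d z" using zD by simp
  finally have psi: "\<bar>\<psi> (drop_x1 k w) - \<psi> (drop_x1 k z)\<bar> \<le> K * (2 * sqrt \<alpha> + 1) * c * d z" .
  have "c * d z + K * (2 * sqrt \<alpha> + 1) * c * d z = B * c * d z" by (simp add: B_def algebra_simps)
  then have sum: "c * d z + K * (2 * sqrt \<alpha> + 1) * c * d z = d z / 2" by (simp add: Bc)
  moreover have "0 \<le> K * (2 * sqrt \<alpha> + 1) * c * d z" using K_nonneg \<alpha> c zD by simp
  ultimately have dw: "d z / 2 \<le> d w"
    using Re psi by (auto simp: depth_def min_def split: if_splits)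
  have cd: "c * d z \<le> d z / 2" using c_le zD mult_right_mono[of c "1/2" "d z"] by simp
  have Rew: "Re (z $ k) / 2 \<le> Re (w $ k)" using Re cd zD by linarith
  \<comment> \<open>The aperture comes from |w|^2 \<le> 2|z|^2 + 2d(z) < (2\<alpha> + 2) d(z) and
    d(z) \<le> 2d(w).\<close>
  have "w \<in> A (4 * \<alpha> + 4)"
  proof (rule A_I)
    show "norm w < r" using nw' small by linarith
    show "0 < d w" using dw zD by linarith
    have "(norm w)\<^sup>2 \<le> (norm z + sqrt (d z))\<^sup>2" using nw cs by (intro power_mono) auto
    also have "\<dots> \<le> 2 * (norm z)\<^sup>2 + 2 * (sqrt (d z))\<^sup>2"
      using sum_squares_bound[of "norm z" "sqrt (d z)"] by (simp add: power2_sum)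
    also have "\<dots> < 2 * (\<alpha> * d z) + 2 * d z" using zD by simp
    also have "\<dots> = (4 * \<alpha> + 4) * (d z / 2)" by (simp add: algebra_simps)
    also have "\<dots> \<le> (4 * \<alpha> + 4) * d w" using dw \<alpha> by (intro mult_left_mono) auto
    finally show "(norm w)\<^sup>2 < (4 * \<alpha> + 4) * d w" .
    have "\<bar>Im (w $ k)\<bar> \<le> \<bar>Im (z $ k)\<bar> + c * d z" using Im by linarith
    also have "\<dots> < \<alpha> * Re (z $ k) + Re (z $ k)" using zD cd by linarith
    also have "\<dots> \<le> (4 * \<alpha> + 4) * (Re (z $ k) / 2)" using zD \<alpha> by (simp add: algebra_simps)
    also have "\<dots> \<le> (4 * \<alpha> + 4) * Re (w $ k)" using Rew \<alpha> by (intro mult_left_mono) auto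
    finally show "\<bar>Im (w $ k)\<bar> < (4 * \<alpha> + 4) * Re (w $ k)" .
  qed
  with nw' show "z + axis j h \<in> A (4 * \<alpha> + 4) \<and> norm (z + axis j h) \<le> norm z + sqrt (norm z)"
    by (simp add: w_def)
qed

text \<open>Near 0 in the region of aperture 4\<alpha> + 4, f is either \<eta>-close to a constant
  or at least 1/\<eta> in modulus. Cauchy's estimate on the axis discs bounds each weighted partial
  by \<eta>/c, and \<eta> is chosen so that the n bounds add up to e/2.\<close>

lemma nabla_if_admissible_limit:
  assumes holo: "holomorphic_Cn_on f D" and lim: "has_admissible_limit k D \<psi> V f L" and \<alpha>: "0 < \<alpha>"
  shows "((\<lambda>z. inverse (1 + (cmod (f z))\<^sup>2) * nabla k \<psi> f z) \<longlongrightarrow> 0) (at 0 within A \<alpha>)"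
proof (rule tendstoI)
  fix e :: real assume e: "0 < e"
  obtain c where c: "0 < c" and disc: "\<And>z j h. z \<in> A \<alpha> \<Longrightarrow> norm z \<le> 1 \<Longrightarrow> norm z + sqrt (norm z) < r \<Longrightarrow>
      cmod h \<le> c * polyradius k \<psi> z j \<Longrightarrow>
      z + axis j h \<in> A (4 * \<alpha> + 4) \<and> norm (z + axis j h) \<le> norm z + sqrt (norm z)"
    using axis_disc_in_A[OF \<alpha>] by metis
  define \<eta> where "\<eta> = e * c / (2 * real CARD('n))"
  have \<eta>: "0 < \<eta>" using e c by (simp add: \<eta>_def)
  have \<beta>: "0 < 4 * \<alpha> + 4" using \<alpha> by simp
  \<comment> \<open>Covers finite and infinite limits at once and passes to subsets, hence from the
    region to each axis disc.\<close>
  define P where "P = (\<lambda>S. (\<exists>l. \<forall>w\<in>S. cmod (f w - l) \<le> \<eta>) \<or> (\<forall>w\<in>S. inverse \<eta> \<le> cmod (f w)))"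
  have P_mono: "P T" if "P S" "T \<subseteq> S" for S T using that unfolding P_def by blast
  have "tends_to_extended f L (at 0 within A (4 * \<alpha> + 4))"
    using lim \<beta> unfolding has_admissible_limit_def by blast
  then have "\<exists>\<delta>>0. P {w \<in> A (4 * \<alpha> + 4). w \<noteq> 0 \<and> norm w < \<delta>}"
  proof (cases L)
    case (Finite l)
    with \<open>tends_to_extended f L _\<close> have "\<forall>\<^sub>F w in at 0 within A (4 * \<alpha> + 4). dist (f w) l < \<eta>"
      using tendstoD[OF _ \<eta>] by simp
    then show ?thesis
      unfolding eventually_at P_def by (force simp: dist_norm intro: less_imp_le)
  next
    case Infinity
    with \<open>tends_to_extended f L _\<close>
    have "\<forall>\<^sub>F w in at 0 within A (4 * \<alpha> + 4). inverse \<eta> \<le> cmod (f w)"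
      by (simp add: filterlim_at_infinity_conv_norm_at_top filterlim_at_top)
    then show ?thesis
      unfolding eventually_at P_def by force
  qed
  then obtain \<delta> where \<delta>: "0 < \<delta>" and P: "P {w \<in> A (4 * \<alpha> + 4). w \<noteq> 0 \<and> norm w < \<delta>}" by blast
  have "((\<lambda>z. norm z + sqrt (norm z)) \<longlongrightarrow> 0) (at 0 within A \<alpha>)"
    by (auto intro!: tendsto_eq_intros)
  moreover have "((\<lambda>z. norm z) \<longlongrightarrow> 0) (at 0 within A \<alpha>)" by (auto intro!: tendsto_eq_intros)
  ultimately have "\<forall>\<^sub>F z in at 0 within A \<alpha>. norm z + sqrt (norm z) < min r \<delta> \<and> norm z < 1 \<and> z \<in> A \<alpha>"
    using \<delta> r_pos by (intro eventually_conj order_tendstoD(2)) (auto simp: eventually_at_filter)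
  then show "\<forall>\<^sub>F z in at 0 within A \<alpha>. dist (inverse (1 + (cmod (f z))\<^sup>2) * nabla k \<psi> f z) 0 < e"
  proof eventually_elim
    case (elim z)
    then have z: "z \<in> A \<alpha>" by simp
    note zD = A_D[OF z \<alpha>]
    define q where "q = inverse (1 + (cmod (f z))\<^sup>2)"
    have q: "0 \<le> q" by (simp add: q_def)
    have nabla_nonneg: "0 \<le> nabla k \<psi> f z"
      using zD by (simp add: nabla_eq_L2_set L2_set_nonneg)
    have partial: "q * (polyradius k \<psi> z j * cmod (complex_partial j f z)) \<le> \<eta> / c" for j
    proof -
      define \<rho> where "\<rho> = polyradius k \<psi> z j"
      have \<rho>: "0 < \<rho>" using zD by (simp add: \<rho>_def polyradius_def)
      define \<phi> where "\<phi> = (\<lambda>h. f (z + axis j h))"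
      have \<phi>0: "\<phi> 0 = f z" by (simp add: \<phi>_def axis_def zero_vec_def[symmetric])
      have mem: "z + axis j h \<in> {w \<in> A (4 * \<alpha> + 4). w \<noteq> 0 \<and> norm w < \<delta>}" if "h \<in> cball 0 (c * \<rho>)" for h
      proof -
        have w: "z + axis j h \<in> A (4 * \<alpha> + 4)" "norm (z + axis j h) \<le> norm z + sqrt (norm z)"
          using disc[OF z, of h j] that elim by (auto simp: \<rho>_def)
        \<comment> \<open>The limit at 0 says nothing about the point 0 itself; positive depth keeps
          the disc away from it.\<close>
        moreover have "z + axis j h \<noteq> 0" using A_D(2,6)[OF w(1) \<beta>] by auto
        ultimately show ?thesis using elim by auto
      qed
      have "P ((\<lambda>h. z + axis j h) ` cball 0 (c * \<rho>))"
        by (rule P_mono[OF P]) (intro image_subsetI mem)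
      then obtain l where "(\<forall>h\<in>cball 0 (c * \<rho>). cmod (\<phi> h - l) \<le> \<eta>)
          \<or> (\<forall>h\<in>cball 0 (c * \<rho>). inverse \<eta> \<le> cmod (\<phi> h))"
        unfolding P_def \<phi>_def by auto
      moreover have "cball 0 (c * \<rho>) \<subseteq> {h. z + axis j h \<in> D}"
      proof
        fix h :: complex assume "h \<in> cball 0 (c * \<rho>)"
        from mem[OF this] show "h \<in> {h. z + axis j h \<in> D}" using A_D(1)[OF _ \<beta>] by blast
      qed
      moreover have "0 < c * \<rho>" using c \<rho> by simp
      ultimately have "inverse (1 + (cmod (\<phi> 0))\<^sup>2) * cmod (deriv \<phi> 0) \<le> \<eta> / (c * \<rho>)"
        using holomorphic_Cn_on_slice[OF holo, of z j] \<eta>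
        by (intro spherical_derivative_bound[where S = "{h. z + axis j h \<in> D}" and l = l])
          (simp_all add: \<phi>_def)
      then have "q * cmod (complex_partial j f z) \<le> \<eta> / (c * \<rho>)"
        by (simp only: \<phi>0 q_def complex_partial_def flip: \<phi>_def)
      then show ?thesis
        using \<rho> c unfolding \<rho>_def[symmetric] by (simp add: field_simps)
    qed
    have "q * nabla k \<psi> f z
        \<le> q * (\<Sum>j\<in>UNIV. polyradius k \<psi> z j * cmod (complex_partial j f z))"
      using zD by (intro mult_left_mono nabla_le_sum q) simp
    also have "\<dots> = (\<Sum>j\<in>UNIV. q * (polyradius k \<psi> z j * cmod (complex_partial j f z)))"
      by (rule sum_distrib_left)
    also have "\<dots> \<le> (\<Sum>j\<in>(UNIV :: 'n set). \<eta> / c)" by (intro sum_mono partial)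
    also have "\<dots> < e" using e c by (simp add: \<eta>_def)
    finally show ?case using q nabla_nonneg by (simp add: q_def)
  qed
qed

end

section \<open>Passage to adapted coordinates\<close>

text \<open>The gradient \<open>G\<close> vanishes at 0 and is differentiable there, hence |G(y)|
  \<le> (|H(0)| + 1) |y| near 0. The mean value inequality turns this into
  \<open>psi_diff\<close>.\<close>

lemma graph_representation_adapted_graph:
  fixes D V :: "(complex ^ 'n) set"
  assumes "graph_representation k D \<psi> V"
  obtains K r where "adapted_graph k D V \<psi> K r"
proof -
  define \<Psi> where "\<Psi> = (\<lambda>z. \<psi> (drop_x1 k z))"
  obtain W where "open V" "0 \<in> V" "\<psi> 0 = 0" and d0: "(\<Psi> has_derivative (\<lambda>_. 0)) (at 0)"
    and "closure V \<subseteq> W" and C2: "C2_on \<Psi> W" and DW: "D \<inter> W = {z \<in> W. Re (z $ k) > \<Psi> z}"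
    using assms unfolding graph_representation_def \<Psi>_def by blast
  then have "0 \<in> W" using closure_subset by blast
  obtain G H where "open W" and G: "\<And>x. x \<in> W \<Longrightarrow> (\<Psi> has_derivative (\<lambda>h. G x \<bullet> h)) (at x)"
    and H: "\<And>x. x \<in> W \<Longrightarrow> (G has_derivative blinfun_apply (H x)) (at x)"
    using C2 unfolding C2_on_def by blast
  have "(\<lambda>h. G 0 \<bullet> h) = (\<lambda>_. 0)"
    using G[OF \<open>0 \<in> W\<close>] d0 by (rule has_derivative_unique)
  then have "G 0 \<bullet> G 0 = 0" by meson
  then have G0: "G 0 = 0" by simp
  obtain e where e: "0 < e" "ball 0 e \<subseteq> V \<inter> W"
    using \<open>open V\<close> \<open>open W\<close> \<open>0 \<in> V\<close> \<open>0 \<in> W\<close> by (meson Int_iff open_Int open_contains_ball)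
  have "\<exists>\<delta>>0. \<forall>y. norm (y - 0) < \<delta> \<longrightarrow> norm (G y - G 0 - H 0 (y - 0)) \<le> 1 * norm (y - 0)"
    using H[OF \<open>0 \<in> W\<close>] unfolding has_derivative_at_alt by (metis zero_less_one)
  then obtain \<delta> where \<delta>: "0 < \<delta>" "\<And>y. norm y < \<delta> \<Longrightarrow> norm (G y - H 0 y) \<le> norm y"
    by (auto simp: G0)
  define K where "K = norm (H 0) + 1"
  define r where "r = min e \<delta>"
  have K: "0 \<le> K" by (simp add: K_def)
  have G_le: "norm (G y) \<le> K * norm y" if "norm y < r" for y
    using \<delta>(2)[of y] that norm_triangle_sub[of "G y" "H 0 y"] norm_blinfun[of "H 0" y]
    by (simp add: r_def K_def distrib_right)
  have "adapted_graph k D V \<psi> K r"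
  proof
    show "0 \<le> K" "0 < r" "ball 0 r \<subseteq> V" "\<psi> 0 = 0"
      using K e \<delta> \<open>\<psi> 0 = 0\<close> by (auto simp: r_def)
    show "z \<in> D \<longleftrightarrow> Re (z $ k) > \<psi> (drop_x1 k z)" if "norm z < r" for z
    proof -
      have "z \<in> W" using that e by (auto simp: r_def)
      then show ?thesis using DW by (auto simp: \<Psi>_def)
    qed
    fix x y :: "complex ^ 'n" assume xy: "norm x < r" "norm y < r"
    \<comment> \<open>The ball of radius \<open>R\<close> about 0 is convex, contains
      \<open>x\<close> and \<open>y\<close>, and carries the gradient bound
      \<open>K * R\<close>.\<close>
    define R where "R = max (norm x) (norm y)"
    have "norm (\<Psi> x - \<Psi> y) \<le> (K * R) * norm (x - y)"
    proof (rule differentiable_bound[OF convex_cball[of 0 R]])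
      fix z :: "complex ^ 'n" assume "z \<in> cball 0 R"
      then have z: "norm z \<le> R" "norm z < r" using xy by (auto simp: R_def)
      then have "z \<in> W" using e by (auto simp: r_def)
      then show "(\<Psi> has_derivative (\<lambda>h. G z \<bullet> h)) (at z within cball 0 R)"
        using G has_derivative_at_withinI by blast
      have "norm (G z) \<le> K * R"
        using G_le[OF z(2)] mult_left_mono[OF z(1) K] by linarith
      moreover have "onorm (\<lambda>h. G z \<bullet> h) \<le> norm (G z)"
        by (rule onorm_bound) (simp_all add: Cauchy_Schwarz_ineq2)
      ultimately show "onorm (\<lambda>h. G z \<bullet> h) \<le> K * R" by linarith
    qed (auto simp: R_def)
    also have "\<dots> \<le> K * (norm x + norm y) * norm (x - y)"
      using K by (intro mult_right_mono mult_left_mono) (auto simp: R_def)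
    finally show "\<bar>\<psi> (drop_x1 k x) - \<psi> (drop_x1 k y)\<bar> \<le> K * (norm x + norm y) * norm (x - y)"
      by (simp add: \<Psi>_def)
  qed
  then show ?thesis by (rule that)
qed

lemma has_derivative_complex_affine:
  fixes M :: "complex ^ 'n ^ 'm"
  shows "((\<lambda>w. a + M *v w) has_derivative (\<lambda>w. M *v w)) (at w)"
proof -
  \<comment> \<open>Real scaling is a case of complex scaling, so complex homogeneity of
    \<open>M\<close> yields real linearity.\<close>
  have scale: "t *\<^sub>R v = complex_of_real t *s v" for t and v :: "complex ^ 'l"
    unfolding vec_eq_iff vector_scaleR_component vector_smult_component
    by (simp add: scaleR_conv_of_real)
  have "linear (\<lambda>w. M *v w)"
    by (rule linearI) (simp_all add: matrix_vector_right_distrib scale vector_scalar_commute)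
  then have "((\<lambda>w. M *v w) has_derivative (\<lambda>w. M *v w)) (at w)"
    by (simp add: linear_conv_bounded_linear bounded_linear_imp_has_derivative)
  from has_derivative_add[OF has_derivative_const this] show ?thesis by simp
qed

lemma holomorphic_Cn_on_affine_vimage:
  fixes M :: "complex ^ 'n ^ 'n"
  assumes "holomorphic_Cn_on f D"
  shows "holomorphic_Cn_on (\<lambda>w. f (a + M *v w)) {w. a + M *v w \<in> D}"
  unfolding holomorphic_Cn_on_def
proof (intro conjI ballI)
  have "continuous_on UNIV (\<lambda>w. a + M *v w)"
    using has_derivative_at_withinI[OF has_derivative_complex_affine]
    by (rule has_derivative_continuous_on)
  then show "open {w. a + M *v w \<in> D}"
    using assms unfolding holomorphic_Cn_on_def
    by (simp add: continuous_on_open_vimage vimage_def)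
next
  fix w assume "w \<in> {w. a + M *v w \<in> D}"
  then obtain F where F: "(f has_derivative F) (at (a + M *v w))" and lin: "\<And>c v. F (c *s v) = c * F v"
    using assms unfolding holomorphic_Cn_on_def by blast
  have "((\<lambda>w. f (a + M *v w)) has_derivative (\<lambda>v. F (M *v v))) (at w)"
    using has_derivative_complex_affine F by (rule has_derivative_compose)
  moreover have "F (M *v (c *s v)) = c * F (M *v v)" for c v
    by (simp only: vector_scalar_commute lin)
  ultimately show "\<exists>F. ((\<lambda>w. f (a + M *v w)) has_derivative F) (at w) \<and> (\<forall>c v. F (c *s v) = c * F v)"
    by blast
qed

theorem theorem2p3:
  fixes D V D' :: "(complex ^ 'n) set"
    and \<xi> \<nu> :: "complex ^ 'n"
    and f f' :: "complex ^ 'n \<Rightarrow> complex"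
    and k :: 'n
    and U :: "complex ^ 'n ^ 'n"
    and \<psi> :: "complex ^ 'n \<Rightarrow> real"
  assumes "CARD('n) > 1"
    and "open D" and "connected D" and "C2_boundary D"
    and "\<xi> \<in> frontier D"
    and "unit_outward_normal D \<xi> \<nu>"
    and "holomorphic_Cn_on f D"
    and "\<exists>L. tends_to_extended (\<lambda>t::real. f (\<xi> - t *\<^sub>R \<nu>)) L (at_right 0)"
    and "unitary_matrix U" and "U *v (- \<nu>) = axis k 1"
    and "D' = (\<lambda>z. U *v (z - \<xi>)) ` D"
    and "f' = (\<lambda>w. f (\<xi> + conj_transpose U *v w))"
    and "graph_representation k D' \<psi> V"
  shows "(\<exists>L. has_admissible_limit k D' \<psi> V f' L) \<longleftrightarrow>
    (\<forall>\<alpha>>0. ((\<lambda>z. inverse (1 + (cmod (f' z))\<^sup>2) * nabla k \<psi> f' z) \<longlongrightarrow> 0)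
               (at 0 within approach_region k D' \<psi> V \<alpha>))"
proof -
  let ?U' = "conj_transpose U"
  have inv: "?U' *v (U *v w) = w" "U *v (?U' *v w) = w" for w
    using assms(9) by (simp_all add: unitary_matrix_def matrix_vector_mul_assoc)
  \<comment> \<open>As a preimage under the inverse affine map, \<open>D'\<close> fits
    \<open>holomorphic_Cn_on_affine_vimage\<close>.\<close>
  have D': "D' = {w. \<xi> + ?U' *v w \<in> D}"
  proof -
    have "w \<in> D'" if "\<xi> + ?U' *v w \<in> D" for w
      unfolding assms(11) using inv(2)[of w] that by (intro image_eqI[of _ _ "\<xi> + ?U' *v w"]) auto
    then show ?thesis unfolding assms(11) by (auto simp: inv)
  qed
  have holo: "holomorphic_Cn_on f' D'"
    unfolding assms(12) D' using assms(7) by (rule holomorphic_Cn_on_affine_vimage)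
  \<comment> \<open>The inverse unitary map sends the distinguished axis to the inner normal, so the
    assumed normal limit becomes a limit along \<open>t *\<^sub>R axis k 1\<close>.\<close>
  have "?U' *v axis k 1 = - \<nu>" using inv(1)[of "- \<nu>"] assms(10) by simp
  moreover have "?U' *v (t *\<^sub>R axis k 1) = t *\<^sub>R (?U' *v axis k 1)" for t
    using has_derivative_linear[OF has_derivative_complex_affine] by (rule linear_scale)
  ultimately have "f' (t *\<^sub>R axis k 1) = f (\<xi> - t *\<^sub>R \<nu>)" for t
    by (simp add: assms(12))
  then obtain L where L: "tends_to_extended (\<lambda>t::real. f' (t *\<^sub>R axis k 1)) L (at_right 0)"
    using assms(8) by auto
  obtain K r where "adapted_graph k D' V \<psi> K r"
    using assms(13) by (rule graph_representation_adapted_graph)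
  then interpret adapted_graph k D' V \<psi> K r .
  show ?thesis
    using admissible_limit_if_nabla[OF holo L] nabla_if_admissible_limit[OF holo] by blast
qed

end
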